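(* Let the following data be given: (i) a nonconstant rational function $p(x)\in\mathbf{Q}(x)\setminus\mathbf{Q}$ without pole at $x=0$; (ii) a formal power series $x(t)\in t+t^2\mathbf{Q}[\![t]\!]$ such that $p(x(t))\in\mathbf{Z}[\![t]\!]$; (iii) a holomorphic map $\varphi:\overline{D(0,1)}\to\mathbf{C}$ (holomorphic on a neighborhood of the closed unit disc) with $\varphi(0)=0$, $|\varphi'(0)|>1$, and such that $p\circ\varphi\in\mathcal{O}(\overline{D(0,1)})$. Suppose that $f_1,\dots,f_m\in\mathbf{Q}[\![x]\!]$ are linearly independent over $\mathbf{Q}(p(x))$ and satisfy $f_i(x(t))\in\mathbf{Z}[\![t]\!]$ and $f_i\circ\varphi\in\mathcal{O}(\overline{D(0,1)})$ for all $i=1,\dots,m$. Then every $f_i$ is algebraic over $\mathbf{Q}(x)$, and $$m\le e\cdot\frac{\int_{\mathbf{T}}\log^+|p\circ\varphi|\,\mu_{\mathrm{Haar}}}{\log|\varphi'(0)|},$$ where $e=2.718\ldots$ is Euler's number.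
   Context: $\mathcal{O}(\overline{D(0,1)})\subset\mathbf{C}[\![z]\!]$ denotes the ring of power series converging on some open neighborhood of the closed unit disc $|z|\le1$. For a formal power series $g\in\mathbf{Q}[\![x]\!]$, $g\circ\varphi$ denotes the formal composite $g(\varphi(z))\in\mathbf{C}[\![z]\!]$ (well defined since $\varphi(0)=0$), and the condition $g\circ\varphi\in\mathcal{O}(\overline{D(0,1)})$ means this composite power series converges on a neighborhood of the closed unit disc; similarly $p\circ\varphi$ is the composition with the rational function $p$, required to be holomorphic on a neighborhood of the closed disc. $\mathbf{T}=\{|z|=1\}$ is the unit circle with normalized Haar (arclength) measure $\mu_{\mathrm{Haar}}$, and $\log^+ y=\max(0,\log y)$. *)

theory Defs
  imports
    "HOL-Complex_Analysis.Complex_Analysis"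
    "HOL-Computational_Algebra.Computational_Algebra"
    "HOL-Computational_Algebra.Field_as_Ring"
begin

text \<open>
  Elements of the field \<open>\<rat>(x)\<close> are modelled by the type \<^typ>\<open>rat poly fract\<close>;
  \<^const>\<open>quot_of_fract\<close> yields coprime numerator and denominator.
\<close>

definition ratfun_num :: "rat poly fract \<Rightarrow> rat poly" where
  "ratfun_num p = fst (quot_of_fract p)"

definition ratfun_denom :: "rat poly fract \<Rightarrow> rat poly" where
  "ratfun_denom p = snd (quot_of_fract p)"

definition ratfun_const :: "rat \<Rightarrow> rat poly fract" where
  "ratfun_const c = Fract [:c:] 1"

definition ratfun_pole_at :: "rat poly fract \<Rightarrow> rat \<Rightarrow> bool" where
  "ratfun_pole_at p a \<longleftrightarrow> poly (ratfun_denom p) a = 0"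

text \<open>The Taylor expansion at \<open>0\<close>; meaningful only if \<open>0\<close> is not a pole.\<close>

definition ratfun_fps :: "rat poly fract \<Rightarrow> rat fps" where
  "ratfun_fps p = fps_of_poly (ratfun_num p) / fps_of_poly (ratfun_denom p)"

text \<open>
  The value at a pole is the junk value \<open>0\<close>.  As numerator and denominator are coprime,
  \<open>ratfun_eval p\<close> is unbounded near every pole, so if \<open>\<phi>\<close> is holomorphic and nonconstant
  on a connected neighbourhood of a point, then \<open>\<lambda>z. ratfun_eval p (\<phi> z)\<close> is holomorphic
  near that point only if \<open>\<phi>\<close> does not take it to a pole.
\<close>

definition ratfun_eval :: "rat poly fract \<Rightarrow> complex \<Rightarrow> complex" where
  "ratfun_eval p z =
     poly (map_poly of_rat (ratfun_num p)) z / poly (map_poly of_rat (ratfun_denom p)) z"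

definition fps_integral_coeffs :: "rat fps \<Rightarrow> bool" where
  "fps_integral_coeffs F \<longleftrightarrow> (\<forall>n. fps_nth F n \<in> \<int>)"

definition complex_fps :: "rat fps \<Rightarrow> complex fps" where
  "complex_fps F = Abs_fps (\<lambda>n. of_rat (fps_nth F n))"

definition O_closed_disc :: "complex fps set" where
  "O_closed_disc =
     {F. \<exists>U. open U \<and> cball 0 1 \<subseteq> U \<and> (\<forall>z\<in>U. summable (\<lambda>n. fps_nth F n * z ^ n))}"

text \<open>
  The subfield \<open>\<rat>(h)\<close> of the field \<open>\<rat>((x))\<close> of formal Laurent series.  In particular
  \<open>\<rat>(x)\<close> is \<open>rat_adjoin fls_X\<close>.
\<close>

definition rat_adjoin :: "rat fls \<Rightarrow> rat fls set" where
  "rat_adjoin h =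
     {poly (map_poly fls_const A) h / poly (map_poly fls_const B) h | A B.
        poly (map_poly fls_const B) h \<noteq> 0}"

definition lin_indep_over :: "'a::field set \<Rightarrow> 'i set \<Rightarrow> ('i \<Rightarrow> 'a) \<Rightarrow> bool" where
  "lin_indep_over K I v \<longleftrightarrow>
     (\<forall>c. (\<forall>i\<in>I. c i \<in> K) \<and> (\<Sum>i\<in>I. c i * v i) = 0 \<longrightarrow> (\<forall>i\<in>I. c i = 0))"

definition algebraic_over :: "'a::field set \<Rightarrow> 'a \<Rightarrow> bool" where
  "algebraic_over K a \<longleftrightarrow> (\<exists>P. P \<noteq> 0 \<and> (\<forall>n. coeff P n \<in> K) \<and> poly P a = 0)"

text \<open>
  Normalised Haar measure on the unit circle.  The target is restricted to the circle so that
  integrands need not be measurable off the circle.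
\<close>

definition haar_circle :: "complex measure" where
  "haar_circle = distr (uniform_measure lborel {0..2 * pi}) (restrict_space borel (sphere 0 1)) cis"

text \<open>Here \<open>log_plus 0 = 0\<close>, in accordance with \<open>log 0 = -\<infinity>\<close>, because \<open>ln 0 = 0\<close>.\<close>

definition log_plus :: "real \<Rightarrow> real" where
  "log_plus y = max 0 (ln y)"

end

theory Submission
  imports Defs "Jordan_Normal_Form.Determinant" "HOL-Probability.Probability"
    "HOL-Real_Asymp.Real_Asymp"
begin

text \<open>
  Put \<open>P = p \<circ> \<phi>\<close>, \<open>T = \<integral> log\<^sup>+ |P|\<close>, and consider the \<open>N = mD\<close> power series \<open>p\<^sup>j f\<^sub>i\<close> with
  \<open>j < D\<close>, which are linearly independent over \<open>\<rat>\<close>.  The nonzero elements of their span have at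
  least \<open>N\<close> distinct vanishing orders \<open>n\<^sub>1 < \<dots> < n\<^sub>N\<close> at \<open>0\<close>.  The determinant of the \<open>t\<close>-coefficients
  of the \<open>p\<^sup>j f\<^sub>i\<close> at these orders is a nonzero integer.  Composing with \<open>\<phi>\<close> instead of \<open>x(t)\<close>, and
  multiplying all series by \<open>v\<^sup>D\<close>, only changes the leading coefficients of an echelon basis, hence
  multiplies the determinant by \<open>v(0)\<^bsup>DN\<^esup> \<phi>'(0)\<^bsup>n\<^sub>1 + \<dots> + n\<^sub>N\<^esup>\<close>, where
  \<open>n\<^sub>1 + \<dots> + n\<^sub>N \<ge> N(N-1)/2\<close>.  Choose \<open>v = exp (-q)\<close> with a polynomial \<open>q\<close> such that \<open>Re q\<close> is slightly
  larger than \<open>log\<^sup>+ |P|\<close> on the unit circle.  Then \<open>P\<^sup>j v\<^sup>D\<close> is bounded by \<open>1\<close>, so the new determinant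
  is at most \<open>N! C\<^sup>N\<close>, while \<open>log |v(0)|\<close> is close to \<open>-T\<close>.  Letting \<open>D \<rightarrow> \<infinity>\<close> yields
  \<open>m log |\<phi>'(0)| \<le> 2T\<close>, which is stronger than required as \<open>2 < e\<close>.  If some \<open>f\<^sub>i\<close> were
  transcendental, this bound would apply to arbitrarily many of its powers.
\<close>

section \<open>Vanishing orders and determinants\<close>

text \<open>Gaussian elimination by induction on the equations \<open>S\<close>: an equation with a
  nonzero coefficient is solved for one unknown, which lowers both cardinalities by one.\<close>

lemma underdetermined_system:
  fixes a :: "'i \<Rightarrow> 's \<Rightarrow> 'a::field"
  assumes "finite S" "finite I" "card S < card I"
  shows "\<exists>c. (\<exists>i\<in>I. c i \<noteq> 0) \<and> (\<forall>s\<in>S. (\<Sum>i\<in>I. c i * a i s) = 0)"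
  using assms
proof (induction S arbitrary: I a rule: finite_induct)
  case empty
  then have "I \<noteq> {}" by auto
  then show ?case by (intro exI[of _ "\<lambda>_. 1"]) auto
next
  case (insert s S)
  show ?case
  proof (cases "\<forall>i\<in>I. a i s = 0")
    case True
    have "card S < card I" using insert by auto
    from insert.IH[OF insert.prems(1) this, of a] obtain c
      where "\<exists>i\<in>I. c i \<noteq> 0" "\<forall>s\<in>S. (\<Sum>i\<in>I. c i * a i s) = 0" by blast
    with True show ?thesis by (intro exI[of _ c]) auto
  next
    case False
    then obtain r where r: "r \<in> I" "a r s \<noteq> 0" by blast
    \<comment> \<open>What remains of equation \<open>t\<close> once equation \<open>s\<close> has
      been solved for the unknown \<open>r\<close>.\<close>
    define b where "b i t = a i t - a i s / a r s * a r t" for i t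
    have "card S < card (I - {r})" using insert r by auto
    from insert.IH[OF _ this, of b] insert.prems obtain c
      where c: "\<exists>i\<in>I - {r}. c i \<noteq> 0" "\<forall>s\<in>S. (\<Sum>i\<in>I - {r}. c i * b i s) = 0" by auto
    \<comment> \<open>The value at \<open>r\<close> is the one that equation \<open>s\<close>
      forces.\<close>
    define d where "d = c(r := - (\<Sum>i\<in>I - {r}. c i * (a i s / a r s)))"
    have "(\<Sum>i\<in>I. d i * a i t) = (\<Sum>i\<in>I - {r}. c i * b i t)" for t
    proof -
      have "(\<Sum>i\<in>I. d i * a i t) = d r * a r t + (\<Sum>i\<in>I - {r}. d i * a i t)"
        using r insert.prems by (intro sum.remove) auto
      also have "(\<Sum>i\<in>I - {r}. d i * a i t) = (\<Sum>i\<in>I - {r}. c i * a i t)"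
        by (intro sum.cong) (auto simp: d_def)
      finally show ?thesis
        by (simp add: d_def b_def algebra_simps sum_subtractf sum_distrib_left sum_distrib_right)
    qed
    moreover have "b i s = 0" for i using r by (simp add: b_def)
    moreover have "\<exists>i\<in>I. d i \<noteq> 0" using c(1) by (auto simp: d_def)
    ultimately show ?thesis using c(2) by (intro exI[of _ d]) auto
  qed
qed

text \<open>With fewer orders than series, some nontrivial combination would have zero coefficients
  at all orders in \<open>S\<close>. By independence it is nonzero, so its own order belongs to
  \<open>S\<close>, yet its coefficient there is not zero.\<close>

lemma card_subdegrees_ge:
  fixes a :: "'i \<Rightarrow> 'a::field fps"
  assumes "finite I"
    and indep: "\<And>c. (\<Sum>i\<in>I. fps_const (c i) * a i) = 0 \<Longrightarrow> \<forall>i\<in>I. c i = 0"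
  defines "S \<equiv> {subdegree (\<Sum>i\<in>I. fps_const (c i) * a i) | c. (\<Sum>i\<in>I. fps_const (c i) * a i) \<noteq> 0}"
  shows "infinite S \<or> card I \<le> card S"
proof (rule ccontr)
  assume "\<not> ?thesis"
  then have "finite S" "card S < card I" by auto
  from underdetermined_system[OF this(1) \<open>finite I\<close> this(2), of "\<lambda>i. fps_nth (a i)"] obtain c
    where c: "\<exists>i\<in>I. c i \<noteq> 0" "\<forall>s\<in>S. (\<Sum>i\<in>I. c i * fps_nth (a i) s) = 0" by blast
  define b where "b = (\<Sum>i\<in>I. fps_const (c i) * a i)"
  have "b \<noteq> 0" using c(1) indep[of c] by (auto simp: b_def)
  moreover have "subdegree b \<in> S" using \<open>b \<noteq> 0\<close> by (auto simp: S_def b_def)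
  then have "fps_nth b (subdegree b) = 0" using c(2) by (simp add: b_def fps_sum_nth)
  ultimately show False by simp
qed

lemma exists_echelon_combinations:
  fixes a :: "nat \<Rightarrow> 'a::field fps"
  assumes indep: "\<And>c. (\<Sum>i<N. fps_const (c i) * a i) = 0 \<Longrightarrow> \<forall>i<N. c i = 0"
  obtains u :: "nat \<Rightarrow> nat \<Rightarrow> 'a" and n :: "nat \<Rightarrow> nat"
  where "strict_mono_on {..<N} n"
    and "\<And>k. k < N \<Longrightarrow> (\<Sum>i<N. fps_const (u k i) * a i) \<noteq> 0"
    and "\<And>k. k < N \<Longrightarrow> subdegree (\<Sum>i<N. fps_const (u k i) * a i) = n k"
proof -
  define S where "S = {subdegree (\<Sum>i<N. fps_const (c i) * a i) | c. (\<Sum>i<N. fps_const (c i) * a i) \<noteq> 0}"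
  have "infinite S \<or> N \<le> card S"
    using card_subdegrees_ge[of "{..<N}" a] indep unfolding S_def by auto
  \<comment> \<open>Whether \<open>S\<close> is infinite or merely large enough, \<open>N\<close>
    orders can be picked; \<open>n\<close> lists them increasingly.\<close>
  then obtain R where R: "R \<subseteq> S" "card R = N" "finite R"
    by (metis infinite_arbitrarily_large obtain_subset_with_card_n)
  define n where "n k = sorted_list_of_set R ! k" for k
  have mono: "strict_mono_on {..<N} n"
    using R sorted_wrt_nth_less[OF strict_sorted_list_of_set]
    by (auto simp: strict_mono_on_def n_def)
  have "n k \<in> S" if "k < N" for k
    using that R nth_mem[of k "sorted_list_of_set R"] by (auto simp: n_def)
  then have "\<exists>c. (\<Sum>i<N. fps_const (c i) * a i) \<noteq> 0 \<and>
      subdegree (\<Sum>i<N. fps_const (c i) * a i) = n k" if "k < N" for k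
    using that by (force simp: S_def)
  then obtain u where "\<And>k. k < N \<Longrightarrow> (\<Sum>i<N. fps_const (u k i) * a i) \<noteq> 0 \<and>
      subdegree (\<Sum>i<N. fps_const (u k i) * a i) = n k"
    by metis
  with mono that show ?thesis by blast
qed

lemma strict_mono_on_lessThan_ge:
  fixes n :: "nat \<Rightarrow> nat"
  assumes "strict_mono_on {..<N} n" "k < N"
  shows "k \<le> n k"
  using assms(2)
proof (induction k)
  case (Suc k)
  then have "k \<le> n k" "n k < n (Suc k)"
    using assms(1) by (auto simp: strict_mono_on_def)
  then show ?case by simp
qed simp

text \<open>Entry \<open>(k, l)\<close> of the product matrix is the coefficient at order
  \<open>n l\<close> of the \<open>k\<close>-th combination. It vanishes for \<open>l < k\<close>
  because then \<open>n l < n k\<close>, so only the diagonal contributes to the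
  determinant.\<close>

lemma det_echelon:
  fixes u :: "nat \<Rightarrow> nat \<Rightarrow> 'a::idom" and a :: "nat \<Rightarrow> 'a fps"
  assumes n: "strict_mono_on {..<N} n"
    and low: "\<And>k j. k < N \<Longrightarrow> j < n k \<Longrightarrow> (\<Sum>i<N. u k i * fps_nth (a i) j) = 0"
  shows "Determinant.det (Matrix.mat N N (\<lambda>(k, i). u k i)) *
           Determinant.det (Matrix.mat N N (\<lambda>(i, k). fps_nth (a i) (n k))) =
         (\<Prod>k<N. \<Sum>i<N. u k i * fps_nth (a i) (n k))"
proof -
  let ?U = "Matrix.mat N N (\<lambda>(k, i). u k i)" and ?A = "Matrix.mat N N (\<lambda>(i, k). fps_nth (a i) (n k))"
  have entry: "(?U * ?A) $$ (k, l) = (\<Sum>i<N. u k i * fps_nth (a i) (n l))" if "k < N" "l < N" for k l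
    using that by (simp add: scalar_prod_def lessThan_atLeast0)
  have "upper_triangular (?U * ?A)"
    unfolding upper_triangular_def
  proof (intro allI impI)
    fix k l assume "k < dim_row (?U * ?A)" "l < k"
    then have "k < N" "l < N" "n l < n k" using n by (auto simp: strict_mono_on_def)
    then show "(?U * ?A) $$ (k, l) = 0" using entry low by simp
  qed
  then have "Determinant.det (?U * ?A) = prod_list (diag_mat (?U * ?A))"
    by (intro det_upper_triangular[where n = N]) auto
  also have "\<dots> = (\<Prod>k<N. (?U * ?A) $$ (k, k))"
    by (simp add: prod_list_diag_prod lessThan_atLeast0)
  also have "\<dots> = (\<Prod>k<N. \<Sum>i<N. u k i * fps_nth (a i) (n k))"
    by (intro prod.cong refl) (use entry in auto)
  finally show ?thesis
    by (subst (asm) det_mult[of _ N]) auto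
qed

text \<open>The Leibniz formula has \<open>N!\<close> terms, each a product of \<open>N\<close>
  entries. The crude factor \<open>N!\<close> is affordable: after an \<open>N\<close>-th root and a
  logarithm it costs at most \<open>ln N\<close>.\<close>

lemma norm_det_le:
  fixes A :: "complex mat"
  assumes "A \<in> carrier_mat N N" "\<And>i k. i < N \<Longrightarrow> k < N \<Longrightarrow> norm (A $$ (i, k)) \<le> C"
  shows "norm (Determinant.det A) \<le> fact N * C ^ N"
proof -
  have "norm (Determinant.det A) \<le>
      (\<Sum>q | q permutes {0..<N}. norm (signof q * (\<Prod>i = 0..<N. A $$ (i, q i))))"
    unfolding det_def'[OF assms(1)] by (rule norm_sum)
  also have "\<dots> \<le> (\<Sum>q | q permutes {0..<N}. C ^ N)"
  proof (rule sum_mono)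
    fix q assume "q \<in> {q. q permutes {0..<N}}"
    then have "q i < N" if "i < N" for i
      using that permutes_in_image[of q "{0..<N}" i] by auto
    then have "(\<Prod>i = 0..<N. norm (A $$ (i, q i))) \<le> (\<Prod>i = 0..<N. C)"
      by (intro prod_mono) (use assms(2) in auto)
    then show "norm (signof q * (\<Prod>i = 0..<N. A $$ (i, q i))) \<le> C ^ N"
      by (auto simp: norm_mult prod_norm sign_def)
  qed
  also have "\<dots> = fact N * C ^ N" by (simp add: card_permutations)
  finally show ?thesis .
qed

lemma det_in_Ints:
  fixes A :: "'a::comm_ring_1 mat"
  assumes "A \<in> carrier_mat N N" "\<And>i k. i < N \<Longrightarrow> k < N \<Longrightarrow> A $$ (i, k) \<in> \<int>"
  shows "Determinant.det A \<in> \<int>"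
  unfolding det_def'[OF assms(1)]
proof (intro Ints_sum Ints_mult Ints_prod)
  fix q i assume "q \<in> {q. q permutes {0..<N}}" "i \<in> {0..<N}"
  then show "A $$ (i, q i) \<in> \<int>"
    using assms(2) permutes_in_image[of q "{0..<N}" i] by auto
qed (auto simp: sign_def)

section \<open>Leading coefficients of composites and products\<close>

lemma fps_compose_nth_low:
  fixes b c :: "'a::comm_ring_1 fps"
  assumes "fps_nth c 0 = 0" "\<And>i. i < n \<Longrightarrow> fps_nth b i = 0" "k < n"
  shows "fps_nth (b oo c) k = 0"
  using assms by (simp add: fps_compose_nth)

text \<open>Below index \<open>n\<close> the coefficients of \<open>b\<close> vanish, and powers of
  \<open>c\<close> beyond the \<open>n\<close>-th start after degree \<open>n\<close>; a single term
  is left.\<close>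

lemma fps_compose_nth_lead:
  fixes b c :: "'a::comm_ring_1 fps"
  assumes "fps_nth c 0 = 0" "\<And>i. i < n \<Longrightarrow> fps_nth b i = 0"
  shows "fps_nth (b oo c) n = fps_nth b n * fps_nth c 1 ^ n"
proof -
  have "fps_nth (b oo c) n = (\<Sum>i\<in>{n}. fps_nth b i * fps_nth (c ^ i) n)"
    unfolding fps_compose_nth using assms by (intro sum.mono_neutral_right) auto
  then show ?thesis using startsby_zero_power_nth_same[OF assms(1)] by simp
qed

lemma fps_mult_nth_low:
  fixes b v :: "'a::comm_ring_1 fps"
  assumes "\<And>i. i < n \<Longrightarrow> fps_nth b i = 0" "k < n"
  shows "fps_nth (v * b) k = 0"
  unfolding fps_mult_nth using assms by (intro sum.neutral) auto

lemma fps_mult_nth_lead: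
  fixes b v :: "'a::comm_ring_1 fps"
  assumes "\<And>i. i < n \<Longrightarrow> fps_nth b i = 0"
  shows "fps_nth (v * b) n = fps_nth v 0 * fps_nth b n"
proof -
  have "fps_nth (v * b) n = (\<Sum>i\<in>{0}. fps_nth v i * fps_nth b (n - i))"
    unfolding fps_mult_nth using assms by (intro sum.mono_neutral_right) auto
  then show ?thesis by simp
qed

section \<open>Dominating functions on the unit circle\<close>

text \<open>On the circle \<open>cnj z\<close> is the inverse of \<open>z\<close>, so the product is
  a Laurent polynomial. Its negative powers can be conjugated into positive ones without changing
  the real part.\<close>

lemma Re_poly_times_cnj_on_circle:
  fixes A B :: "complex poly"
  shows "\<exists>C. \<forall>z\<in>sphere 0 1. Re (poly A z * cnj (poly B z)) = Re (poly C z)"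
proof (induction B arbitrary: A)
  case 0
  show ?case by (intro exI[of _ 0]) simp
next
  case (pCons b B)
  obtain a A' where A: "A = pCons a A'" by (cases A)
  from pCons.IH obtain C where C: "\<And>z. z \<in> sphere 0 1 \<Longrightarrow> Re (poly A' z * cnj (poly B z)) = Re (poly C z)"
    by blast
  show ?case
  \<comment> \<open>Expanding with \<open>z * cnj z = 1\<close> gives three summands. The middle
    one, \<open>a * cnj (z * poly B z)\<close>, is replaced by its conjugate; the last one,
    \<open>poly A' z * cnj (poly B z)\<close>, is covered by the induction hypothesis.\<close>
  proof (intro exI[of _ "Polynomial.smult (cnj b) A + Polynomial.smult (cnj a) (pCons 0 B) + C"] ballI)
    fix z :: complex assume z: "z \<in> sphere 0 1"
    then have "z * cnj z = 1" by (simp add: complex_norm_square[symmetric])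
    then have "poly A z * cnj (poly (pCons b B) z) =
        cnj b * poly A z + cnj (cnj a * (z * poly B z)) + poly A' z * cnj (poly B z)"
      by (simp add: A algebra_simps)
    then show "Re (poly A z * cnj (poly (pCons b B) z)) =
        Re (poly (Polynomial.smult (cnj b) A + Polynomial.smult (cnj a) (pCons 0 B) + C) z)"
      using C[OF z] by (simp add: algebra_simps)
  qed
qed

text \<open>Stone-Weierstrass for the real parts of polynomials, which form an algebra on the circle
  by the preceding lemma and separate points because they include \<open>Re\<close> and
  \<open>Im\<close>.\<close>

lemma continuous_circle_approx_Re_poly:
  fixes h :: "complex \<Rightarrow> real"
  assumes "continuous_on (sphere 0 1) h" "0 < \<epsilon>"
  shows "\<exists>q. \<forall>z\<in>sphere 0 1. \<bar>h z - Re (poly q z)\<bar> < \<epsilon>"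
proof -
  define P where "P F \<longleftrightarrow> (\<exists>q. \<forall>z\<in>sphere 0 1. F z = Re (poly q z))" for F :: "complex \<Rightarrow> real"
  have "\<exists>g. P g \<and> (\<forall>z\<in>sphere 0 1. \<bar>h z - g z\<bar> < \<epsilon>)"
  proof (rule Stone_Weierstrass_HOL)
    show "P (\<lambda>_. c)" for c
      unfolding P_def by (intro exI[of _ "[:of_real c:]"]) simp
    show "continuous_on (sphere 0 1) F" if PF: "P F" for F
    proof -
      from PF obtain q where q: "\<And>z. z \<in> sphere 0 1 \<Longrightarrow> F z = Re (poly q z)" by (auto simp: P_def)
      have "continuous_on (sphere 0 1) (\<lambda>z. Re (poly q z))" by (intro continuous_intros)
      then show ?thesis by (rule continuous_on_eq) (use q in auto)
    qed
    show "P (\<lambda>z. F z + G z)" if "P F \<and> P G" for F G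
    proof -
      from that obtain q r where "\<forall>z\<in>sphere 0 1. F z = Re (poly q z)" "\<forall>z\<in>sphere 0 1. G z = Re (poly r z)"
        by (auto simp: P_def)
      then show ?thesis unfolding P_def by (intro exI[of _ "q + r"]) simp
    qed
    show "P (\<lambda>z. F z * G z)" if "P F \<and> P G" for F G
    proof -
      from that obtain q r where qr: "\<forall>z\<in>sphere 0 1. F z = Re (poly q z)" "\<forall>z\<in>sphere 0 1. G z = Re (poly r z)"
        by (auto simp: P_def)
      obtain C where C: "\<forall>z\<in>sphere 0 1. Re (poly q z * cnj (poly r z)) = Re (poly C z)"
        using Re_poly_times_cnj_on_circle by blast
      \<comment> \<open>This identity reduces a product of real parts to \<open>a * b\<close>, a
        polynomial already, and \<open>a * cnj b\<close>, which becomes one through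
        \<open>C\<close>.\<close>
      have "Re a * Re b = Re (1/2 * (a * b) + 1/2 * (a * cnj b))" for a b by (simp add: field_simps)
      then show ?thesis unfolding P_def using qr C
        by (intro exI[of _ "Polynomial.smult (1/2) (q * r) + Polynomial.smult (1/2) C"]) (simp add: field_simps)
    qed
    show "\<exists>F. P F \<and> F x \<noteq> F y" if "x \<in> sphere 0 1 \<and> y \<in> sphere 0 1 \<and> x \<noteq> y" for x y
    proof -
      have "P Re" unfolding P_def by (intro exI[of _ "[:0, 1:]"]) simp
      moreover have "P Im" unfolding P_def by (intro exI[of _ "[:0, -\<i>:]"]) simp
      ultimately show ?thesis using that complex_eqI by blast
    qed
  qed (use assms in auto)
  then show ?thesis unfolding P_def by fastforce
qed

section \<open>Integration over the unit circle\<close>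

lemma cis_measurable_circle:
  "cis \<in> uniform_measure lborel {0..2 * pi} \<rightarrow>\<^sub>M restrict_space borel (sphere 0 1)"
proof (rule measurable_restrict_space2)
  have "cis \<in> borel_measurable borel"
    by (intro borel_measurable_continuous_onI continuous_intros)
  then show "cis \<in> borel_measurable (uniform_measure lborel {0..2 * pi})"
    by (simp add: measurable_def sets_eq_imp_space_eq)
qed auto

lemma prob_space_haar_circle: "prob_space haar_circle"
  unfolding haar_circle_def
  by (intro prob_space.prob_space_distr prob_space_uniform_measure cis_measurable_circle) auto

lemma space_haar_circle [simp]: "space haar_circle = sphere 0 1"
  by (simp add: haar_circle_def space_restrict_space)

lemma integrable_haar_circle:
  fixes h :: "complex \<Rightarrow> 'a::{second_countable_topology, banach}"
  assumes "continuous_on (sphere 0 1) h"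
  shows "integrable haar_circle h"
proof -
  interpret prob_space haar_circle by (rule prob_space_haar_circle)
  have "bounded (h ` sphere 0 1)"
    by (intro compact_imp_bounded compact_continuous_image assms) auto
  then obtain K where K: "\<And>z. z \<in> sphere 0 1 \<Longrightarrow> norm (h z) \<le> K"
    unfolding bounded_iff by blast
  have "h \<in> borel_measurable (restrict_space borel (sphere 0 1))"
    using assms by (rule borel_measurable_continuous_on_restrict)
  then have "h \<in> borel_measurable haar_circle"
    by (simp add: haar_circle_def)
  then show ?thesis
    by (intro integrable_const_bound[where B = K]) (auto intro!: AE_I2 K)
qed

text \<open>The antiderivative \<open>cis (n * t) / (\<i> * n)\<close> takes the same value at both
  ends of the period.\<close>

lemma integral_haar_circle_power:
  assumes "0 < n"
  shows "(\<integral>z. z ^ n \<partial>haar_circle) = 0"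
proof -
  have "(\<lambda>z. z ^ n) \<in> borel_measurable (restrict_space borel (sphere 0 1 :: complex set))"
    by (intro borel_measurable_continuous_on_restrict continuous_intros)
  then have "(\<integral>z. z ^ n \<partial>haar_circle) = (\<integral>t. cis t ^ n \<partial>uniform_measure lborel {0..2 * pi})"
    unfolding haar_circle_def by (intro integral_distr cis_measurable_circle)
  also have "uniform_measure lborel {0..2 * pi} = density lborel (\<lambda>t. ennreal (indicator {0..2 * pi} t / (2 * pi)))"
    unfolding uniform_measure_def
    by (auto intro!: density_cong simp: indicator_def divide_ennreal[symmetric])
  also have "(\<integral>t. cis t ^ n \<partial>\<dots>) = (\<integral>t. (1 / (2 * pi)) *\<^sub>R (indicator {0..2 * pi} t *\<^sub>R cis (real n * t)) \<partial>lborel)"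
  proof (subst integral_density)
    show "(\<lambda>t. cis t ^ n) \<in> borel_measurable lborel"
      by (auto intro!: borel_measurable_continuous_onI continuous_intros)
  qed (auto simp: Complex.DeMoivre intro!: Bochner_Integration.integral_cong)
  also have "\<dots> = (1 / (2 * pi)) *\<^sub>R (\<integral>t. indicator {0..2 * pi} t *\<^sub>R cis (real n * t) \<partial>lborel)"
    by (rule integral_scaleR_right)
  also have "(\<integral>t. indicator {0..2 * pi} t *\<^sub>R cis (real n * t) \<partial>lborel) =
      cis (real n * (2 * pi)) / (\<i> * n) - cis (real n * 0) / (\<i> * n)"
  proof (rule integral_FTC_atLeastAtMost[where F = "\<lambda>t. cis (real n * t) / (\<i> * n)"])
    show "((\<lambda>t. cis (real n * t) / (\<i> * n)) has_vector_derivative cis (real n * t)) (at t within {0..2 * pi})" for t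
      unfolding cis_conv_exp using assms
      by (auto intro!: derivative_eq_intros has_vector_derivative_real_field simp: field_simps)
  qed (auto intro!: continuous_intros)
  also have "cis (real n * (2 * pi)) = 1"
    by (metis cis_multiple_2pi mult.commute Ints_of_nat)
  finally show ?thesis by simp
qed

text \<open>The mean value property: only the constant term survives integration. It turns an upper
  bound for \<open>Re q\<close> on the circle into one at the centre.\<close>

lemma integral_haar_circle_poly: "(\<integral>z. poly q z \<partial>haar_circle) = poly q 0"
proof -
  interpret prob_space haar_circle by (rule prob_space_haar_circle)
  have "(\<integral>z. poly q z \<partial>haar_circle) = (\<integral>z. (\<Sum>i\<le>degree q. coeff q i * z ^ i) \<partial>haar_circle)"
    by (simp add: poly_altdef)
  also have "\<dots> = (\<Sum>i\<le>degree q. coeff q i * (\<integral>z. z ^ i \<partial>haar_circle))"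
    by (subst Bochner_Integration.integral_sum)
       (auto intro!: integrable_haar_circle continuous_intros)
  also have "\<dots> = (\<Sum>i\<in>{0}. coeff q i * (\<integral>z. z ^ i \<partial>haar_circle))"
    by (intro sum.mono_neutral_right) (auto simp: integral_haar_circle_power)
  finally show ?thesis by (simp add: poly_0_coeff_0 prob_space[simplified])
qed

text \<open>This form makes continuity at \<open>0\<close> visible, where \<open>ln\<close> itself
  jumps.\<close>

lemma log_plus_eq: "0 \<le> y \<Longrightarrow> log_plus y = ln (max 1 y)"
  by (cases "y = 0") (auto simp: log_plus_def max_def)

lemma log_plus_nonneg: "0 \<le> log_plus y"
  by (simp add: log_plus_def)

lemma le_exp_log_plus: "0 \<le> y \<Longrightarrow> y \<le> exp (log_plus y)"
  by (simp add: log_plus_eq)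

text \<open>Approximating \<open>log_plus\<close> shifted up by \<open>\<epsilon> / 2\<close> within
  \<open>\<epsilon> / 2\<close> keeps \<open>Re q\<close> between \<open>log_plus\<close> and
  \<open>log_plus + \<epsilon>\<close>. Averaging the upper estimate bounds \<open>Re q\<close> at
  \<open>0\<close>.\<close>

lemma exists_dominating_Re_poly:
  fixes P :: "complex \<Rightarrow> complex"
  assumes "continuous_on (sphere 0 1) P" "0 < \<epsilon>"
  shows "\<exists>q. (\<forall>z\<in>sphere 0 1. log_plus (norm (P z)) \<le> Re (poly q z)) \<and>
             Re (poly q 0) \<le> (\<integral>z. log_plus (norm (P z)) \<partial>haar_circle) + \<epsilon>"
proof -
  interpret prob_space haar_circle by (rule prob_space_haar_circle)
  let ?h = "\<lambda>z. log_plus (norm (P z))"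
  have cont: "continuous_on (sphere 0 1) ?h"
    unfolding log_plus_eq[OF norm_ge_zero]
    by (intro continuous_intros assms) auto
  then have "continuous_on (sphere 0 1) (\<lambda>z. ?h z + \<epsilon> / 2)" by (intro continuous_intros)
  from continuous_circle_approx_Re_poly[OF this, of "\<epsilon> / 2"] assms(2) obtain q
    where q: "\<And>z. z \<in> sphere 0 1 \<Longrightarrow> \<bar>?h z + \<epsilon> / 2 - Re (poly q z)\<bar> < \<epsilon> / 2"
    by (meson half_gt_zero)
  have "Re (poly q 0) = (\<integral>z. Re (poly q z) \<partial>haar_circle)"
    unfolding integral_haar_circle_poly[symmetric]
    by (intro integral_Re[symmetric] integrable_haar_circle continuous_intros)
  also have "\<dots> \<le> (\<integral>z. ?h z + \<epsilon> \<partial>haar_circle)"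
  proof (rule integral_mono)
    show "Re (poly q z) \<le> ?h z + \<epsilon>" if "z \<in> space haar_circle" for z
      using q[OF that[unfolded space_haar_circle]] by linarith
  qed (intro integrable_haar_circle continuous_intros cont)+
  also have "\<dots> = (\<integral>z. ?h z \<partial>haar_circle) + \<epsilon>"
    by (subst Bochner_Integration.integral_add)
       (auto intro!: integrable_haar_circle cont simp: prob_space[simplified])
  finally show ?thesis
    using q by (intro exI[of _ q] conjI ballI) (smt (verit, best) field_sum_of_halves)+
qed

section \<open>The determinant inequality\<close>

lemma complex_fps_nth [simp]: "fps_nth (complex_fps F) n = of_rat (fps_nth F n)"
  by (simp add: complex_fps_def)

lemma complex_fps_0 [simp]: "complex_fps 0 = 0"
  by (simp add: fps_eq_iff)

lemma complex_fps_1 [simp]: "complex_fps 1 = 1"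
  by (simp add: fps_eq_iff fps_one_nth)

lemma complex_fps_const [simp]: "complex_fps (fps_const c) = fps_const (of_rat c)"
  by (simp add: fps_eq_iff)

lemma complex_fps_add [simp]: "complex_fps (F + G) = complex_fps F + complex_fps G"
  by (simp add: fps_eq_iff of_rat_add)

lemma complex_fps_mult [simp]: "complex_fps (F * G) = complex_fps F * complex_fps G"
  by (simp add: fps_eq_iff fps_mult_nth of_rat_sum of_rat_mult)

lemma complex_fps_sum [simp]: "complex_fps (sum F I) = (\<Sum>i\<in>I. complex_fps (F i))"
  by (induction I rule: infinite_finite_induct) auto

lemma complex_fps_power [simp]: "complex_fps (F ^ n) = complex_fps F ^ n"
  by (induction n) auto

lemma fps_integral_coeffs_mult:
  "fps_integral_coeffs F \<Longrightarrow> fps_integral_coeffs G \<Longrightarrow> fps_integral_coeffs (F * G)"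
  by (auto simp: fps_integral_coeffs_def fps_mult_nth)

lemma fps_integral_coeffs_power: "fps_integral_coeffs F \<Longrightarrow> fps_integral_coeffs (F ^ n)"
proof (induction n)
  case 0
  then show ?case by (simp add: fps_integral_coeffs_def fps_one_nth)
qed (auto intro: fps_integral_coeffs_mult)

lemma Ints_complex_norm_ge_1: "(a :: complex) \<in> \<int> \<Longrightarrow> a \<noteq> 0 \<Longrightarrow> 1 \<le> norm a"
  by (elim Ints_cases) auto

text \<open>The matrices \<open>M\<close> (composition with \<open>x\<close>) and \<open>M'\<close>
  (composition with \<open>\<Phi>\<close>, weighted by \<open>V\<close>) are read at the same orders
  \<open>n k\<close>. The same \<open>U\<close> makes both triangular, so their determinants differ
  by an explicit factor; \<open>M\<close> has a nonzero integer determinant and \<open>M'\<close>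
  has bounded entries.\<close>

lemma determinant_inequality:
  fixes a :: "nat \<Rightarrow> rat fps" and x :: "rat fps" and \<Phi> V :: "complex fps"
  assumes indep: "\<And>c. (\<Sum>i<N. fps_const (c i) * a i) = 0 \<Longrightarrow> \<forall>i<N. c i = 0"
    and x: "fps_nth x 0 = 0" "fps_nth x 1 = 1"
    and integral: "\<And>i. i < N \<Longrightarrow> fps_integral_coeffs (a i oo x)"
    and \<Phi>: "fps_nth \<Phi> 0 = 0" "1 \<le> norm (fps_nth \<Phi> 1)"
    and bound: "\<And>i k. i < N \<Longrightarrow> norm (fps_nth (V * (complex_fps (a i) oo \<Phi>)) k) \<le> C"
  shows "norm (fps_nth \<Phi> 1) ^ (\<Sum>k<N. k) * norm (fps_nth V 0) ^ N \<le> fact N * C ^ N"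
proof -
  obtain u n where n: "strict_mono_on {..<N} n"
    and u: "\<And>k. k < N \<Longrightarrow> (\<Sum>i<N. fps_const (u k i) * a i) \<noteq> 0"
      "\<And>k. k < N \<Longrightarrow> subdegree (\<Sum>i<N. fps_const (u k i) * a i) = n k"
    by (rule exists_echelon_combinations[of a N, OF indep], assumption, rule that)
  define b where "b k = (\<Sum>i<N. fps_const (u k i) * a i)" for k
  have b_low: "fps_nth (b k) j = 0" if "k < N" "j < n k" for k j
    using that u(2)[of k] by (auto simp: b_def intro: nth_less_subdegree_zero)
  have b_lead: "fps_nth (b k) (n k) \<noteq> 0" if "k < N" for k
    using that u[of k] nth_subdegree_nonzero[of "b k"] by (simp add: b_def)
  define A where "A i = complex_fps (a i oo x)" for i
  define A' where "A' i = V * (complex_fps (a i) oo \<Phi>)" for i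
  have "b k oo x = (\<Sum>i<N. fps_const (u k i) * (a i oo x))" for k
    by (simp add: b_def fps_compose_sum_distrib fps_compose_mult_distrib[OF x(1)])
  then have A_sum: "(\<Sum>i<N. of_rat (u k i) * fps_nth (A i) j) = of_rat (fps_nth (b k oo x) j)" for k j
    by (simp add: A_def fps_sum_nth of_rat_sum of_rat_mult)
  have "V * (complex_fps (b k) oo \<Phi>) = (\<Sum>i<N. fps_const (of_rat (u k i)) * A' i)" for k
    by (simp add: b_def A'_def fps_compose_sum_distrib fps_compose_mult_distrib[OF \<Phi>(1)]
        sum_distrib_left mult_ac)
  then have A'_sum: "(\<Sum>i<N. of_rat (u k i) * fps_nth (A' i) j) =
      fps_nth (V * (complex_fps (b k) oo \<Phi>)) j" for k j
    by (simp add: fps_sum_nth)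
  define U :: "complex mat" where "U = Matrix.mat N N (\<lambda>(k, i). of_rat (u k i))"
  define M where "M = Matrix.mat N N (\<lambda>(i, k). fps_nth (A i) (n k))"
  define M' where "M' = Matrix.mat N N (\<lambda>(i, k). fps_nth (A' i) (n k))"
  have "Determinant.det U * Determinant.det M = (\<Prod>k<N. \<Sum>i<N. of_rat (u k i) * fps_nth (A i) (n k))"
    unfolding U_def M_def
    by (rule det_echelon[OF n]) (simp add: A_sum fps_compose_nth_low[OF x(1) b_low])
  \<comment> \<open>As \<open>x\<close> has linear coefficient \<open>1\<close>, composing with it
    preserves leading coefficients.\<close>
  also have "\<dots> = (\<Prod>k<N. of_rat (fps_nth (b k) (n k)))"
    by (intro prod.cong refl) (simp add: A_sum fps_compose_nth_lead[OF x(1) b_low] x(2)[simplified])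
  finally have det_M: "Determinant.det U * Determinant.det M = (\<Prod>k<N. of_rat (fps_nth (b k) (n k)))" .
  also have "\<dots> \<noteq> 0" using b_lead by simp
  finally have nonzero: "Determinant.det U \<noteq> 0" "Determinant.det M \<noteq> 0" by auto
  have low: "fps_nth (complex_fps (b k) oo \<Phi>) j = 0" if "k < N" "j < n k" for k j
    using that by (intro fps_compose_nth_low[OF \<Phi>(1), of "n k"]) (auto simp: b_low)
  have "Determinant.det U * Determinant.det M' = (\<Prod>k<N. \<Sum>i<N. of_rat (u k i) * fps_nth (A' i) (n k))"
    unfolding U_def M'_def
    by (rule det_echelon[OF n]) (auto simp: A'_sum intro!: fps_mult_nth_low[OF low])
  also have "\<dots> = (\<Prod>k<N. fps_nth V 0 * (of_rat (fps_nth (b k) (n k)) * fps_nth \<Phi> 1 ^ n k))"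
  proof (intro prod.cong refl)
    fix k assume k: "k \<in> {..<N}"
    have "fps_nth (complex_fps (b k) oo \<Phi>) (n k) = of_rat (fps_nth (b k) (n k)) * fps_nth \<Phi> 1 ^ n k"
      using k by (subst fps_compose_nth_lead[OF \<Phi>(1)]) (auto simp: b_low)
    then show "(\<Sum>i<N. of_rat (u k i) * fps_nth (A' i) (n k)) =
        fps_nth V 0 * (of_rat (fps_nth (b k) (n k)) * fps_nth \<Phi> 1 ^ n k)"
      using k by (simp only: A'_sum) (subst fps_mult_nth_lead, auto simp: low)
  qed
  \<comment> \<open>The product of the leading coefficients of the \<open>b k\<close> is
    \<open>det U * det M\<close>, so \<open>det U\<close> cancels and only the factors from
    \<open>V\<close> and \<open>\<Phi>\<close> are left.\<close>
  also have "\<dots> = Determinant.det U * (fps_nth V 0 ^ N * fps_nth \<Phi> 1 ^ (\<Sum>k<N. n k) * Determinant.det M)"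
    using det_M by (simp add: prod.distrib power_sum algebra_simps)
  finally have det_M': "Determinant.det M' = fps_nth V 0 ^ N * fps_nth \<Phi> 1 ^ (\<Sum>k<N. n k) * Determinant.det M"
    using nonzero by simp
  have "Determinant.det M \<in> \<int>"
  proof (rule det_in_Ints)
    show "M \<in> carrier_mat N N" by (simp add: M_def)
    fix i k assume "i < N" "k < N"
    with integral[of i] have "fps_nth (a i oo x) (n k) \<in> \<int>" by (simp add: fps_integral_coeffs_def)
    then have "of_rat (fps_nth (a i oo x) (n k)) \<in> (\<int> :: complex set)" by (elim Ints_cases) simp
    with \<open>i < N\<close> \<open>k < N\<close> show "M $$ (i, k) \<in> \<int>" by (simp add: M_def A_def)
  qed
  then have 1: "1 \<le> norm (Determinant.det M)" using nonzero by (intro Ints_complex_norm_ge_1)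
  have "norm (Determinant.det M') \<le> fact N * C ^ N"
    by (rule norm_det_le) (auto simp: M'_def A'_def bound)
  \<comment> \<open>The orders themselves are unknown; since the linear coefficient of
    \<open>\<Phi>\<close> has norm at least \<open>1\<close>, their sum may be replaced by this
    smaller exponent.\<close>
  have "(\<Sum>k<N. k) \<le> (\<Sum>k<N. n k)"
    by (intro sum_mono) (use strict_mono_on_lessThan_ge[OF n] in auto)
  then have "norm (fps_nth \<Phi> 1) ^ (\<Sum>k<N. k) * norm (fps_nth V 0) ^ N
      \<le> norm (fps_nth \<Phi> 1) ^ (\<Sum>k<N. n k) * norm (fps_nth V 0) ^ N"
    using \<Phi>(2) by (intro mult_right_mono power_increasing) auto
  also have "\<dots> \<le> norm (fps_nth \<Phi> 1) ^ (\<Sum>k<N. n k) * norm (fps_nth V 0) ^ N * norm (Determinant.det M)"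
    using mult_left_mono[OF 1] by simp
  also have "\<dots> = norm (Determinant.det M')"
    by (simp add: det_M' norm_mult norm_power)
  also have "\<dots> \<le> fact N * C ^ N" by fact
  finally show ?thesis .
qed

text \<open>Cauchy's inequality at radius exactly \<open>1\<close> gives a bound independent of
  \<open>n\<close>. This matters because nothing bounds the vanishing orders from above.\<close>

lemma norm_fps_nth_le_circle_bound:
  fixes h :: "complex \<Rightarrow> complex"
  assumes "h analytic_on cball 0 1" "h has_fps_expansion H"
    and "\<And>z. z \<in> sphere 0 1 \<Longrightarrow> norm (h z) \<le> C"
  shows "norm (fps_nth H n) \<le> C"
proof -
  have "h holomorphic_on cball 0 1" using assms(1) by (rule analytic_imp_holomorphic)
  then have "norm ((deriv ^^ n) h 0) \<le> fact n * C / 1 ^ n"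
    by (intro Cauchy_inequality)
       (auto intro: holomorphic_on_imp_continuous_on holomorphic_on_subset assms(3))
  then show ?thesis
    by (simp add: fps_nth_fps_expansion[OF assms(2)] norm_divide field_simps)
qed

lemma O_closed_disc_eval_fps:
  assumes "F \<in> O_closed_disc"
  shows "eval_fps F analytic_on cball 0 1" "eval_fps F has_fps_expansion F"
proof -
  from assms obtain U where U: "open U" "cball 0 1 \<subseteq> U" "\<And>z. z \<in> U \<Longrightarrow> summable (\<lambda>n. fps_nth F n * z ^ n)"
    by (auto simp: O_closed_disc_def)
  obtain e where e: "0 < e" "(\<Union>z\<in>cball 0 1. ball z e) \<subseteq> U"
    using compact_subset_open_imp_ball_epsilon_subset[OF compact_cball U(1,2)] by blast
  \<comment> \<open>Convergence at this one point outside the closed disc already forces a radius of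
    convergence greater than \<open>1\<close>.\<close>
  have "complex_of_real (1 + e / 2) \<in> ball 1 e"
    using e(1) by (simp add: dist_norm)
  then have "complex_of_real (1 + e / 2) \<in> U"
    using e(2) by (auto intro!: bexI[of _ 1] subsetD[OF e(2)])
  then have "ereal (norm (complex_of_real (1 + e / 2))) \<le> fps_conv_radius F"
    unfolding fps_conv_radius_def by (intro conv_radius_geI U(3))
  moreover have "norm (complex_of_real (1 + e / 2)) = 1 + e / 2" using e(1) by (simp only: norm_of_real)
  ultimately have r: "ereal (1 + e / 2) \<le> fps_conv_radius F" by simp
  have "cball (0 :: complex) 1 \<subseteq> eball 0 (fps_conv_radius F)"
  proof
    fix z :: complex assume "z \<in> cball 0 1"
    then have "ereal (norm z) < ereal (1 + e / 2)" using e(1) by simp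
    also note r
    finally show "z \<in> eball 0 (fps_conv_radius F)" by (simp add: in_eball_iff)
  qed
  then show "eval_fps F analytic_on cball 0 1"
    using holomorphic_on_eval_fps[of "eball 0 (fps_conv_radius F)" F]
    by (metis analytic_on_open analytic_on_subset open_eball subset_refl)
  have "0 < ereal (1 + e / 2)" using e(1) by simp
  then have "0 < fps_conv_radius F" using r by (rule less_le_trans)
  then show "eval_fps F has_fps_expansion F" by (rule eval_fps_has_fps_expansion)
qed

section \<open>The fields generated by a power series\<close>

abbreviation fls_poly_eval :: "'a::field poly \<Rightarrow> 'a fls \<Rightarrow> 'a fls" where
  "fls_poly_eval Q H \<equiv> poly (map_poly fls_const Q) H"

lemma fls_poly_eval_add: "fls_poly_eval (A + B) H = fls_poly_eval A H + fls_poly_eval B H"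
  by (induction A B rule: poly_induct2)
     (simp_all add: map_poly_pCons fls_plus_const[symmetric] algebra_simps)

lemma fls_poly_eval_smult: "fls_poly_eval (Polynomial.smult c A) H = fls_const c * fls_poly_eval A H"
  by (induction A) (simp_all add: map_poly_pCons fls_const_mult_const[symmetric] algebra_simps
        del: fls_const_mult_const)

lemma fls_poly_eval_mult: "fls_poly_eval (A * B) H = fls_poly_eval A H * fls_poly_eval B H"
  by (induction A) (simp_all add: map_poly_pCons fls_poly_eval_add fls_poly_eval_smult algebra_simps)

lemma fls_poly_eval_power: "fls_poly_eval (A ^ n) H = fls_poly_eval A H ^ n"
  by (induction n) (simp_all add: fls_poly_eval_mult)

lemma fls_poly_eval_monom: "fls_poly_eval (monom c j) H = fls_const c * H ^ j"
  by (simp add: map_poly_monom poly_monom)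

lemma fls_poly_eval_sum: "fls_poly_eval (\<Sum>j\<in>J. Q j) H = (\<Sum>j\<in>J. fls_poly_eval (Q j) H)"
  by (induction J rule: infinite_finite_induct) (simp_all add: fls_poly_eval_add)

lemma fls_poly_eval_X: "fls_poly_eval Q fls_X = fps_to_fls (fps_of_poly Q)"
  by (induction Q)
     (simp_all add: map_poly_pCons fps_of_poly_pCons fls_times_fps_to_fls mult.commute)

text \<open>Tracking the constant term shows that the value is nonzero whenever \<open>Q\<close>
  does not vanish at the constant term of \<open>h\<close>.\<close>

lemma fls_poly_eval_fps_to_fls:
  "\<exists>k. fls_poly_eval Q (fps_to_fls h) = fps_to_fls k \<and> fps_nth k 0 = poly Q (fps_nth h 0)"
proof (induction Q)
  case (pCons a Q)
  then obtain k where "fls_poly_eval Q (fps_to_fls h) = fps_to_fls k" "fps_nth k 0 = poly Q (fps_nth h 0)"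
    by blast
  then show ?case
    by (intro exI[of _ "fps_const a + h * k"]) (simp add: map_poly_pCons fls_times_fps_to_fls pCons.hyps)
qed (auto intro: exI[of _ 0])

text \<open>Factor out the largest power of \<open>y - h(0)\<close> from \<open>Q(y)\<close>: the remaining factor
  evaluates at \<open>h\<close> to a power series with nonzero constant term.\<close>

lemma fls_poly_eval_nonconst_nonzero:
  fixes h :: "'a::field fps"
  assumes "h \<noteq> fps_const (fps_nth h 0)" "Q \<noteq> 0"
  shows "fls_poly_eval Q (fps_to_fls h) \<noteq> 0"
proof -
  define c where "c = fps_nth h 0"
  obtain R where R: "Q = [:- c, 1:] ^ Polynomial.order c Q * R" "\<not> [:- c, 1:] dvd R"
    using order_decomp[OF assms(2)] by blast
  obtain k where k: "fls_poly_eval R (fps_to_fls h) = fps_to_fls k" "fps_nth k 0 = poly R c"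
    using fls_poly_eval_fps_to_fls unfolding c_def by blast
  have "poly R c \<noteq> 0" using R(2) by (simp add: poly_eq_0_iff_dvd)
  then have "k \<noteq> 0" using k(2) by auto
  have "fls_poly_eval [:- c, 1:] (fps_to_fls h) = fps_to_fls (h - fps_const c)"
    by (simp add: map_poly_pCons)
  then have "fls_poly_eval [:- c, 1:] (fps_to_fls h) \<noteq> 0"
    using assms(1) by (simp add: c_def del: fps_to_fls_minus)
  then show ?thesis
    by (subst R(1)) (simp add: fls_poly_eval_mult fls_poly_eval_power k(1) \<open>k \<noteq> 0\<close>)
qed

section \<open>Closure properties of the field generated by a series\<close>

lemma rat_adjoin_eval: "fls_poly_eval A H \<in> rat_adjoin H"
  unfolding rat_adjoin_def by (intro CollectI exI[of _ A] exI[of _ 1]) simp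

lemma rat_adjoin_const: "fls_const c \<in> rat_adjoin H"
  using rat_adjoin_eval[of "[:c:]" H] by (simp add: map_poly_pCons)

lemma rat_adjoin_add:
  assumes "a \<in> rat_adjoin H" "b \<in> rat_adjoin H"
  shows "a + b \<in> rat_adjoin H"
proof -
  from assms obtain A B C D where
    "a = fls_poly_eval A H / fls_poly_eval B H" "fls_poly_eval B H \<noteq> 0"
    "b = fls_poly_eval C H / fls_poly_eval D H" "fls_poly_eval D H \<noteq> 0"
    by (auto simp: rat_adjoin_def)
  then have "a + b = fls_poly_eval (A * D + C * B) H / fls_poly_eval (B * D) H" "fls_poly_eval (B * D) H \<noteq> 0"
    by (simp_all add: fls_poly_eval_mult fls_poly_eval_add add_frac_eq)
  then show ?thesis unfolding rat_adjoin_def by blast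
qed

lemma rat_adjoin_mult:
  assumes "a \<in> rat_adjoin H" "b \<in> rat_adjoin H"
  shows "a * b \<in> rat_adjoin H"
proof -
  from assms obtain A B C D where
    "a = fls_poly_eval A H / fls_poly_eval B H" "fls_poly_eval B H \<noteq> 0"
    "b = fls_poly_eval C H / fls_poly_eval D H" "fls_poly_eval D H \<noteq> 0"
    by (auto simp: rat_adjoin_def)
  then have "a * b = fls_poly_eval (A * C) H / fls_poly_eval (B * D) H" "fls_poly_eval (B * D) H \<noteq> 0"
    by (simp_all add: fls_poly_eval_mult)
  then show ?thesis unfolding rat_adjoin_def by blast
qed

lemma rat_adjoin_divide:
  assumes "a \<in> rat_adjoin H" "b \<in> rat_adjoin H"
  shows "a / b \<in> rat_adjoin H"
proof (cases "b = 0")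
  case True
  then show ?thesis using rat_adjoin_const[of 0 H] by simp
next
  case False
  with assms obtain A B C D where
    "a = fls_poly_eval A H / fls_poly_eval B H" "fls_poly_eval B H \<noteq> 0"
    "b = fls_poly_eval C H / fls_poly_eval D H" "fls_poly_eval D H \<noteq> 0" "fls_poly_eval C H \<noteq> 0"
    by (force simp: rat_adjoin_def)
  then have "a / b = fls_poly_eval (A * D) H / fls_poly_eval (B * C) H" "fls_poly_eval (B * C) H \<noteq> 0"
    by (simp_all add: fls_poly_eval_mult)
  then show ?thesis unfolding rat_adjoin_def by blast
qed

text \<open>Used for the inclusion of the field generated by \<open>p\<close> in the field of
  rational functions: a Horner induction keeps polynomials in \<open>G\<close> inside
  \<open>rat_adjoin H\<close>, and quotients follow.\<close>

lemma rat_adjoin_subset: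
  assumes "G \<in> rat_adjoin H"
  shows "rat_adjoin G \<subseteq> rat_adjoin H"
proof -
  have "fls_poly_eval A G \<in> rat_adjoin H" for A
  proof (induction A)
    case 0
    then show ?case using rat_adjoin_const[of 0 H] by simp
  next
    case (pCons a A)
    then show ?case
      by (auto simp: map_poly_pCons intro!: rat_adjoin_add rat_adjoin_mult rat_adjoin_const assms)
  qed
  then show ?thesis
    unfolding rat_adjoin_def[of G] by (auto intro: rat_adjoin_divide)
qed

section \<open>The dimension bound\<close>

text \<open>Encodes a pair \<open>(i, j)\<close> as \<open>l = i * D + j\<close>, so that the
  products of powers and series can index the rows of a matrix.\<close>

lemma sum_lessThan_mult_div_mod:
  fixes g :: "nat \<Rightarrow> nat \<Rightarrow> 'a::comm_monoid_add"
  shows "(\<Sum>l<m * D. g (l div D) (l mod D)) = (\<Sum>i<m. \<Sum>j<D. g i j)"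
proof -
  have "(\<Sum>l<m * D. g (l div D) (l mod D)) =
      (\<Sum>i<m. \<Sum>l\<in>{i * D..<i * D + D}. g (l div D) (l mod D))"
    by (simp add: sum.nat_group)
  also have "\<dots> = (\<Sum>i<m. \<Sum>j<D. g i j)"
  proof (rule sum.cong[OF refl])
    fix i
    have "(\<Sum>l\<in>{i * D..<i * D + D}. g (l div D) (l mod D)) =
        (\<Sum>j\<in>{0..<D}. g ((j + i * D) div D) ((j + i * D) mod D))"
      using sum.shift_bounds_nat_ivl[of "\<lambda>l. g (l div D) (l mod D)" 0 "i * D" D] by (simp add: add.commute)
    also have "\<dots> = (\<Sum>j<D. g i j)"
      unfolding lessThan_atLeast0 by (intro sum.cong refl) auto
    finally show "(\<Sum>l\<in>{i * D..<i * D + D}. g (l div D) (l mod D)) = (\<Sum>j<D. g i j)" .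
  qed
  finally show ?thesis .
qed

text \<open>Collecting the terms with \<open>f i\<close> gives as coefficient a polynomial in
  \<open>h\<close>, which lies in \<open>rat_adjoin\<close> and hence vanishes. A nonconstant
  \<open>h\<close> is transcendental over the rationals, so that polynomial is zero.\<close>

lemma lin_indep_over_rat_adjoin_monomials:
  fixes h :: "rat fps" and f :: "nat \<Rightarrow> rat fps"
  assumes "h \<noteq> fps_const (fps_nth h 0)"
    and indep: "lin_indep_over (rat_adjoin (fps_to_fls h)) {..<m} (\<lambda>i. fps_to_fls (f i))"
    and zero: "(\<Sum>i<m. \<Sum>j<D. fps_const (c i j) * (h ^ j * f i)) = 0"
    and "i < m" "j < D"
  shows "c i j = 0"
proof -
  define Q where "Q i = (\<Sum>j<D. monom (c i j) j)" for i
  have eval_Q: "fls_poly_eval (Q i) (fps_to_fls h) = (\<Sum>j<D. fls_const (c i j) * fps_to_fls h ^ j)" for i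
    by (simp add: Q_def fls_poly_eval_sum fls_poly_eval_monom)
  have to_fls_sum: "fps_to_fls (sum g J) = (\<Sum>j\<in>J. fps_to_fls (g j))" for g :: "nat \<Rightarrow> rat fps" and J
    by (induction J rule: infinite_finite_induct) auto
  have "(\<Sum>i<m. fls_poly_eval (Q i) (fps_to_fls h) * fps_to_fls (f i)) =
      fps_to_fls (\<Sum>i<m. \<Sum>j<D. fps_const (c i j) * (h ^ j * f i))"
    by (simp add: eval_Q to_fls_sum sum_distrib_right fls_times_fps_to_fls fps_to_fls_power mult.assoc)
  also have "\<dots> = 0" by (simp add: zero)
  finally have "\<forall>i\<in>{..<m}. fls_poly_eval (Q i) (fps_to_fls h) = 0"
    using rat_adjoin_eval
    by (intro indep[unfolded lin_indep_over_def, THEN spec, THEN mp,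
          of "\<lambda>i. fls_poly_eval (Q i) (fps_to_fls h)"] conjI ballI)
  then have "Q i = 0"
    using fls_poly_eval_nonconst_nonzero[OF assms(1)] \<open>i < m\<close> by blast
  then have "coeff (Q i) j = 0" by simp
  then show ?thesis using \<open>j < D\<close> by (simp add: Q_def coeff_sum)
qed

text \<open>Of the \<open>D\<close> factors \<open>v\<close>, exactly \<open>j\<close> are paired
  with factors \<open>w\<close>; the others have norm at most \<open>1\<close>. One weight
  \<open>v ^ D\<close> thus serves all \<open>j\<close> up to \<open>D\<close>.\<close>

lemma norm_dominated_power_le_1:
  fixes v w :: complex
  assumes "norm w * norm v \<le> 1" "norm v \<le> 1" "j \<le> D"
  shows "norm (v ^ D * w ^ j) \<le> 1"
proof -
  have "norm (v ^ D * w ^ j) = norm v ^ (D - j) * (norm w * norm v) ^ j"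
    using assms(3) by (simp add: norm_mult norm_power power_mult_distrib flip: power_add)
  also have "\<dots> \<le> 1 * 1"
    using assms by (intro mult_mono power_le_one) auto
  finally show ?thesis by simp
qed

text \<open>The determinant inequality with weight \<open>V ^ D\<close>, after taking logarithms and
  dividing by \<open>N = m * D\<close>.\<close>

lemma dimension_bound_finite:
  fixes x h :: "rat fps" and \<Phi> :: "complex fps" and P :: "complex \<Rightarrow> complex"
    and f :: "nat \<Rightarrow> rat fps" and q :: "complex poly"
  assumes h_nonconst: "h \<noteq> fps_const (fps_nth h 0)"
    and x: "fps_nth x 0 = 0" "fps_nth x 1 = 1"
    and h_integral: "fps_integral_coeffs (h oo x)"
    and \<Phi>: "fps_nth \<Phi> 0 = 0" "1 < norm (fps_nth \<Phi> 1)"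
    and P: "P analytic_on cball 0 1" "P has_fps_expansion (complex_fps h oo \<Phi>)"
    and indep: "lin_indep_over (rat_adjoin (fps_to_fls h)) {..<m} (\<lambda>i. fps_to_fls (f i))"
    and f_integral: "\<And>i. i < m \<Longrightarrow> fps_integral_coeffs (f i oo x)"
    and g: "\<And>i. i < m \<Longrightarrow> g i analytic_on cball 0 1"
      "\<And>i. i < m \<Longrightarrow> g i has_fps_expansion (complex_fps (f i) oo \<Phi>)"
    and g_bound: "\<And>i z. i < m \<Longrightarrow> z \<in> sphere 0 1 \<Longrightarrow> norm (g i z) \<le> C"
    and q: "\<And>z. z \<in> sphere 0 1 \<Longrightarrow> log_plus (norm (P z)) \<le> Re (poly q z)"
    and pos: "0 < m" "0 < D" "1 \<le> C"
  shows "(real (m * D) - 1) / 2 * ln (norm (fps_nth \<Phi> 1)) \<le> real D * Re (poly q 0) + ln (real (m * D)) + ln C"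
proof -
  \<comment> \<open>On the circle the norm of \<open>v\<close> is at most \<open>1\<close>, and so
    is that of \<open>P * v\<close>, because \<open>Re q\<close> dominates \<open>log_plus\<close>
    of the norm of \<open>P\<close>.\<close>
  define v where "v z = exp (- poly q z)" for z
  have v_analytic: "v analytic_on S" for S
    unfolding v_def poly_altdef by (intro analytic_intros)
  define V where "V = fps_expansion v 0"
  have V: "v has_fps_expansion V"
    unfolding V_def by (intro analytic_at_imp_has_fps_expansion_0 v_analytic)
  have V_0: "fps_nth V 0 = v 0"
    using has_fps_expansion_imp_0_eq_fps_nth_0[OF V] by simp
  define N where "N = m * D"
  have "0 < N" using pos by (simp add: N_def)
  define a where "a l = h ^ (l mod D) * f (l div D)" for l
  have idx: "l div D < m" "l mod D < D" if "l < N" for l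
    using that pos by (auto simp: N_def less_mult_imp_div_less)
  define L where "L = ln (norm (fps_nth \<Phi> 1))"
  have "norm (fps_nth \<Phi> 1) ^ (\<Sum>k<N. k) * norm (fps_nth (V ^ D) 0) ^ N \<le> fact N * C ^ N"
  proof (rule determinant_inequality[where a = a and x = x])
    fix c :: "nat \<Rightarrow> rat" assume c: "(\<Sum>l<N. fps_const (c l) * a l) = 0"
    \<comment> \<open>Writing \<open>l\<close> as \<open>l div D * D + l mod D\<close> exposes the
      dependence on quotient and remainder that the regrouping lemma expects.\<close>
    have "(\<Sum>l<N. fps_const (c l) * a l) =
        (\<Sum>l<m * D. fps_const (c (l div D * D + l mod D)) * (h ^ (l mod D) * f (l div D)))"
      by (simp add: N_def a_def)
    also have "\<dots> = (\<Sum>i<m. \<Sum>j<D. fps_const (c (i * D + j)) * (h ^ j * f i))"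
      by (rule sum_lessThan_mult_div_mod)
    finally have "(\<Sum>i<m. \<Sum>j<D. fps_const (c (i * D + j)) * (h ^ j * f i)) = 0" using c by simp
    from lin_indep_over_rat_adjoin_monomials[OF h_nonconst indep this]
    have "c (l div D * D + l mod D) = 0" if "l < N" for l using idx[OF that] by blast
    then show "\<forall>l<N. c l = 0" by simp
  next
    fix l assume "l < N"
    then show "fps_integral_coeffs (a l oo x)"
      using idx[of l] h_integral f_integral
      by (simp add: a_def fps_compose_mult_distrib[OF x(1)] fps_compose_power[OF x(1), symmetric]
          fps_integral_coeffs_mult fps_integral_coeffs_power)
  next
    fix l k assume "l < N"
    let ?i = "l div D" and ?j = "l mod D"
    have i: "?i < m" and j: "?j < D" using idx \<open>l < N\<close> by auto
    have "norm (fps_nth (V ^ D * ((complex_fps h oo \<Phi>) ^ ?j * (complex_fps (f ?i) oo \<Phi>))) k) \<le> C"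
    proof (rule norm_fps_nth_le_circle_bound)
      show "(\<lambda>z. v z ^ D * (P z ^ ?j * g ?i z)) analytic_on cball 0 1"
        by (intro analytic_intros v_analytic P g i)
      show "(\<lambda>z. v z ^ D * (P z ^ ?j * g ?i z)) has_fps_expansion
          V ^ D * ((complex_fps h oo \<Phi>) ^ ?j * (complex_fps (f ?i) oo \<Phi>))"
        by (intro has_fps_expansion_mult has_fps_expansion_power V P g i)
      fix z :: complex assume z: "z \<in> sphere 0 1"
      have norm_v: "norm (v z) = exp (- Re (poly q z))" by (simp add: v_def)
      have "norm (P z) \<le> exp (Re (poly q z))"
        using le_exp_log_plus[of "norm (P z)"] q[OF z] by (meson exp_le_cancel_iff norm_ge_zero order_trans)
      then have "norm (P z) * norm (v z) \<le> 1"
        by (simp add: norm_v exp_minus field_simps)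
      moreover have "norm (v z) \<le> 1"
        using q[OF z] log_plus_nonneg[of "norm (P z)"] by (simp add: norm_v)
      ultimately have "norm (v z ^ D * P z ^ ?j) * norm (g ?i z) \<le> 1 * C"
        using g_bound[OF i z] j by (intro mult_mono norm_dominated_power_le_1) auto
      then show "norm (v z ^ D * (P z ^ ?j * g ?i z)) \<le> C"
        by (simp add: norm_mult mult.assoc)
    qed
    then show "norm (fps_nth (V ^ D * (complex_fps (a l) oo \<Phi>)) k) \<le> C"
      by (simp add: a_def fps_compose_mult_distrib[OF \<Phi>(1)] fps_compose_power[OF \<Phi>(1)])
  qed (use x \<Phi> in auto)
  \<comment> \<open>Bounding \<open>N!\<close> by \<open>N ^ N\<close> turns the right-hand side
    into a pure \<open>N\<close>-th power.\<close>
  also have "\<dots> \<le> real N ^ N * C ^ N"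
    using fact_le_power[of N, where 'a = real] pos by (intro mult_right_mono) auto
  finally have "norm (fps_nth \<Phi> 1) ^ (\<Sum>k<N. k) * norm (fps_nth (V ^ D) 0) ^ N \<le> (real N * C) ^ N"
    by (simp only: power_mult_distrib)
  moreover have "norm (fps_nth \<Phi> 1) = exp L"
    unfolding L_def by (rule exp_ln[symmetric]) (use \<Phi>(2) in linarith)
  moreover have "norm (fps_nth (V ^ D) 0) = exp (- (real D * Re (poly q 0)))"
    by (simp add: fps_nth_power_0 V_0 v_def norm_power exp_of_nat_mult[symmetric])
  moreover have "real N * C = exp (ln (real N) + ln C)"
    using \<open>0 < N\<close> pos by (simp add: exp_add)
  ultimately have "exp (real (\<Sum>k<N. k) * L - real N * (real D * Re (poly q 0)))
      \<le> exp (real N * (ln (real N) + ln C))"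
    by (simp only: exp_of_nat_mult[symmetric] exp_add[symmetric] mult_minus_right diff_conv_add_uminus)
  then have "real (\<Sum>k<N. k) * L - real N * (real D * Re (poly q 0)) \<le> real N * (ln (real N) + ln C)"
    by simp
  moreover have "real (\<Sum>k<N. k) = real N * ((real N - 1) / 2)"
  proof (induction N)
    case (Suc n)
    then show ?case by (simp add: field_simps)
  qed simp
  ultimately have "real N * ((real N - 1) / 2) * L - real N * (real D * Re (poly q 0)) \<le> real N * (ln (real N) + ln C)"
    by (simp only:)
  then have "real N * ((real N - 1) / 2 * L - real D * Re (poly q 0)) \<le> real N * (ln (real N) + ln C)"
    by (simp only: right_diff_distrib mult.assoc)
  then have "(real N - 1) / 2 * L - real D * Re (poly q 0) \<le> ln (real N) + ln C"
    using \<open>0 < N\<close> by simp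
  then show ?thesis by (simp add: N_def L_def)
qed

text \<open>After division by \<open>D\<close>, the terms \<open>ln (m * D)\<close> and
  \<open>ln C\<close> of the finite bound disappear as \<open>D\<close> grows, leaving
  \<open>m * L / 2\<close> below \<open>Re q\<close> at \<open>0\<close>, hence below the integral
  plus an arbitrary \<open>\<epsilon>\<close>.\<close>

lemma dimension_bound:
  fixes x h :: "rat fps" and \<Phi> :: "complex fps" and P :: "complex \<Rightarrow> complex"
    and f :: "nat \<Rightarrow> rat fps"
  assumes h_nonconst: "h \<noteq> fps_const (fps_nth h 0)"
    and x: "fps_nth x 0 = 0" "fps_nth x 1 = 1"
    and h_integral: "fps_integral_coeffs (h oo x)"
    and \<Phi>: "fps_nth \<Phi> 0 = 0" "1 < norm (fps_nth \<Phi> 1)"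
    and P: "P analytic_on cball 0 1" "P has_fps_expansion (complex_fps h oo \<Phi>)"
    and indep: "lin_indep_over (rat_adjoin (fps_to_fls h)) {..<m} (\<lambda>i. fps_to_fls (f i))"
    and f_integral: "\<And>i. i < m \<Longrightarrow> fps_integral_coeffs (f i oo x)"
    and g: "\<And>i. i < m \<Longrightarrow> g i analytic_on cball 0 1"
      "\<And>i. i < m \<Longrightarrow> g i has_fps_expansion (complex_fps (f i) oo \<Phi>)"
  shows "real m * ln (norm (fps_nth \<Phi> 1)) \<le> 2 * (\<integral>z. log_plus (norm (P z)) \<partial>haar_circle)"
proof (cases "m = 0")
  case True
  then show ?thesis by (simp add: log_plus_nonneg)
next
  case False
  define L where "L = ln (norm (fps_nth \<Phi> 1))"
  have "\<exists>K. \<forall>z\<in>sphere 0 1. norm (g i z) \<le> K" if "i < m" for i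
  proof -
    have "continuous_on (sphere 0 1) (g i)"
      using g(1)[OF that] by (meson analytic_imp_holomorphic continuous_on_subset
          holomorphic_on_imp_continuous_on sphere_cball)
    then have "bounded (g i ` sphere 0 1)"
      by (intro compact_imp_bounded compact_continuous_image) auto
    then show ?thesis unfolding bounded_iff by blast
  qed
  then obtain K where K: "\<And>i z. i < m \<Longrightarrow> z \<in> sphere 0 1 \<Longrightarrow> norm (g i z) \<le> K i" by metis
  define C where "C = 1 + (\<Sum>i<m. \<bar>K i\<bar>)"
  have C: "norm (g i z) \<le> C" if "i < m" "z \<in> sphere 0 1" for i z
  proof -
    have "\<bar>K i\<bar> \<le> (\<Sum>i<m. \<bar>K i\<bar>)" using that by (intro member_le_sum) auto
    then show ?thesis using K[OF that] by (simp add: C_def)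
  qed
  have "1 \<le> C" by (simp add: C_def sum_nonneg)
  have cont: "continuous_on (sphere 0 1) P"
    using P(1) by (meson analytic_imp_holomorphic continuous_on_subset
        holomorphic_on_imp_continuous_on sphere_cball)
  have "real m * L / 2 \<le> (\<integral>z. log_plus (norm (P z)) \<partial>haar_circle) + \<epsilon>" if "0 < \<epsilon>" for \<epsilon>
  proof -
    obtain q where q: "\<And>z. z \<in> sphere 0 1 \<Longrightarrow> log_plus (norm (P z)) \<le> Re (poly q z)"
      "Re (poly q 0) \<le> (\<integral>z. log_plus (norm (P z)) \<partial>haar_circle) + \<epsilon>"
      using exists_dominating_Re_poly[OF cont \<open>0 < \<epsilon>\<close>] by blast
    have "(\<lambda>D. ((real m * real D - 1) / 2 * L - ln (real m * real D) - ln C) / real D)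
        \<longlonglongrightarrow> real m * L / 2"
      using False by real_asymp
    moreover have "((real m * real D - 1) / 2 * L - ln (real m * real D) - ln C) / real D \<le> Re (poly q 0)"
      if "1 \<le> D" for D
      using dimension_bound_finite[where D = D and m = m and C = C and q = q and g = g and f = f,
          OF h_nonconst x h_integral \<Phi> P indep f_integral g C q(1)]
        that False \<open>1 \<le> C\<close> by (simp add: L_def field_simps)
    ultimately have "real m * L / 2 \<le> Re (poly q 0)"
      by (intro LIMSEQ_le_const2[where X = "\<lambda>D. ((real m * real D - 1) / 2 * L - ln (real m * real D) - ln C) / real D"]) blast+
    then show ?thesis using q(2) by simp
  qed
  then have "real m * L / 2 \<le> (\<integral>z. log_plus (norm (P z)) \<partial>haar_circle)"
    by (rule field_le_epsilon)
  then show ?thesis by (simp add: L_def)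
qed

section \<open>Expansions of rational functions\<close>

lemma poly_of_rat_has_fps_expansion:
  "(\<lambda>z. poly (map_poly of_rat q) z) has_fps_expansion complex_fps (fps_of_poly q)"
proof (induction q)
  case (pCons a q)
  have "complex_fps fps_X = fps_X" by (simp add: fps_eq_iff fps_X_def)
  then have "complex_fps (fps_of_poly (pCons a q)) = fps_const (of_rat a) + fps_X * complex_fps (fps_of_poly q)"
    by (simp add: fps_of_poly_pCons mult.commute)
  moreover have "(\<lambda>z. of_rat a + z * poly (map_poly of_rat q) z) has_fps_expansion
      fps_const (of_rat a) + fps_X * complex_fps (fps_of_poly q)"
    by (intro fps_expansion_intros pCons.IH)
  ultimately show ?case by (simp add: map_poly_pCons)
qed simp

lemma ratfun_fps_mult_denom:
  assumes "\<not> ratfun_pole_at p 0"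
  shows "ratfun_fps p * fps_of_poly (ratfun_denom p) = fps_of_poly (ratfun_num p)"
proof -
  have "fps_nth (fps_of_poly (ratfun_denom p)) 0 \<noteq> 0"
    using assms by (simp add: ratfun_pole_at_def poly_0_coeff_0)
  then have "is_unit (fps_of_poly (ratfun_denom p))" by simp
  then show ?thesis unfolding ratfun_fps_def by (simp add: unit_imp_dvd)
qed

text \<open>A constant expansion makes the numerator a scalar multiple of the denominator, so the
  fraction itself is constant.\<close>

lemma ratfun_fps_nonconst:
  assumes "p \<notin> range ratfun_const" "\<not> ratfun_pole_at p 0"
  shows "ratfun_fps p \<noteq> fps_const c"
proof
  assume "ratfun_fps p = fps_const c"
  then have "fps_of_poly (ratfun_num p) = fps_of_poly (Polynomial.smult c (ratfun_denom p))"
    using ratfun_fps_mult_denom[OF assms(2)] by (simp add: fps_of_poly_smult)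
  then have num: "ratfun_num p = Polynomial.smult c (ratfun_denom p)" by (simp only: fps_of_poly_eq_iff)
  have "p = Fract (ratfun_num p) (ratfun_denom p)"
    by (simp add: ratfun_num_def ratfun_denom_def)
  also have "\<dots> = Fract [:c:] 1"
    unfolding num by (subst eq_fract(1)) (auto simp: ratfun_denom_def)
  finally show False using assms(1) by (auto simp: ratfun_const_def)
qed

lemma ratfun_fps_in_rat_adjoin_X:
  assumes "\<not> ratfun_pole_at p 0"
  shows "fps_to_fls (ratfun_fps p) \<in> rat_adjoin fls_X"
proof -
  have "fps_of_poly (ratfun_denom p) \<noteq> 0" by (simp add: ratfun_denom_def)
  moreover have "fps_to_fls (ratfun_fps p) * fps_to_fls (fps_of_poly (ratfun_denom p)) =
      fps_to_fls (fps_of_poly (ratfun_num p))"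
    using ratfun_fps_mult_denom[OF assms] by (simp flip: fls_times_fps_to_fls)
  ultimately have "fps_to_fls (ratfun_fps p) = fls_poly_eval (ratfun_num p) fls_X / fls_poly_eval (ratfun_denom p) fls_X"
    by (simp add: fls_poly_eval_X field_simps)
  then show ?thesis by (simp only: rat_adjoin_divide rat_adjoin_eval)
qed

text \<open>As \<open>0\<close> is not a pole, the denominator composed with \<open>\<Phi>\<close>
  has nonzero constant term; dividing by it is legitimate for functions and for series
  alike.\<close>

lemma ratfun_eval_compose_has_fps_expansion:
  assumes "\<not> ratfun_pole_at p 0" "\<phi> has_fps_expansion \<Phi>" "fps_nth \<Phi> 0 = 0"
  shows "(\<lambda>z. ratfun_eval p (\<phi> z)) has_fps_expansion (complex_fps (ratfun_fps p) oo \<Phi>)"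
proof -
  let ?n = "complex_fps (fps_of_poly (ratfun_num p))" and ?d = "complex_fps (fps_of_poly (ratfun_denom p))"
  have d0: "fps_nth (?d oo \<Phi>) 0 \<noteq> 0"
    using assms(1) by (simp add: ratfun_pole_at_def poly_0_coeff_0)
  have "(\<lambda>z. ratfun_eval p (\<phi> z)) has_fps_expansion (?n oo \<Phi>) / (?d oo \<Phi>)"
    unfolding ratfun_eval_def
    using has_fps_expansion_compose[OF poly_of_rat_has_fps_expansion assms(2,3)] d0
    by (intro has_fps_expansion_divide') (auto simp: o_def)
  moreover have "(complex_fps (ratfun_fps p) oo \<Phi>) * (?d oo \<Phi>) = ?n oo \<Phi>"
    unfolding fps_compose_mult_distrib[OF assms(3), symmetric] complex_fps_mult[symmetric]
      ratfun_fps_mult_denom[OF assms(1)] ..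
  moreover have "?d oo \<Phi> \<noteq> 0" using d0 by (metis fps_zero_nth)
  ultimately show ?thesis by (metis nonzero_mult_div_cancel_right)
qed

section \<open>Linear independence, algebraicity and the final estimate\<close>

lemma lin_indep_over_Suc:
  assumes "lin_indep_over K {1..m} v"
  shows "lin_indep_over K {..<m} (\<lambda>i. v (Suc i))"
  unfolding lin_indep_over_def
proof (intro allI impI, elim conjE)
  fix c assume c: "\<forall>i\<in>{..<m}. c i \<in> K" "(\<Sum>i<m. c i * v (Suc i)) = 0"
  have "(\<Sum>i\<in>{1..m}. c (i - 1) * v i) = (\<Sum>i<m. c i * v (Suc i))"
    by (rule sum.reindex_bij_witness[of _ Suc "\<lambda>i. i - 1"]) auto
  moreover have "\<forall>i\<in>{1..m}. c (i - 1) \<in> K" using c(1) by auto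
  ultimately have "\<forall>i\<in>{1..m}. c (i - 1) = 0"
    using assms c(2) unfolding lin_indep_over_def by (elim allE[of _ "\<lambda>i. c (i - 1)"]) simp
  then show "\<forall>i\<in>{..<m}. c i = 0" by (auto dest!: bspec[of _ _ "Suc _"])
qed

text \<open>A linear relation between powers of \<open>a\<close> is a polynomial equation for
  \<open>a\<close>, with coefficients in the larger set \<open>K'\<close>.\<close>

lemma lin_indep_powers_of_not_algebraic:
  assumes "\<not> algebraic_over K' a" "K \<subseteq> K'" "0 \<in> K'"
  shows "lin_indep_over K {..<M} (\<lambda>k. a ^ k)"
  unfolding lin_indep_over_def
proof (intro allI impI, elim conjE)
  fix c assume c: "\<forall>i\<in>{..<M}. c i \<in> K" "(\<Sum>i<M. c i * a ^ i) = 0"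
  define Q where "Q = (\<Sum>i<M. monom (c i) i)"
  have coeff_Q: "coeff Q n = (if n < M then c n else 0)" for n
    by (simp add: Q_def coeff_sum)
  have "poly Q a = 0" using c(2) by (simp add: Q_def poly_sum poly_monom)
  moreover have "\<forall>n. coeff Q n \<in> K'" using c(1) assms(2,3) by (auto simp: coeff_Q)
  ultimately have "Q = 0" using assms(1) by (auto simp: algebraic_over_def)
  then show "\<forall>i\<in>{..<M}. c i = 0" using coeff_Q by (metis coeff_0 lessThan_iff)
qed

theorem theorem2p1:
  fixes p :: "rat poly fract"
    and x :: "rat fps"
    and \<phi> :: "complex \<Rightarrow> complex"
    and m :: nat
    and f :: "nat \<Rightarrow> rat fps"
  assumes p_nonconst: "p \<notin> range ratfun_const"
    and p_no_pole: "\<not> ratfun_pole_at p 0"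
    and x_0: "fps_nth x 0 = 0"
    and x_1: "fps_nth x 1 = 1"
    and p_x_integral: "fps_integral_coeffs (fps_compose (ratfun_fps p) x)"
    and \<phi>_holo: "\<phi> analytic_on cball 0 1"
    and \<phi>_0: "\<phi> 0 = 0"
    and \<phi>_deriv: "norm (deriv \<phi> 0) > 1"
    and p_\<phi>_holo: "(\<lambda>z. ratfun_eval p (\<phi> z)) analytic_on cball 0 1"
    and f_indep: "lin_indep_over (rat_adjoin (fps_to_fls (ratfun_fps p))) {1..m}
                    (\<lambda>i. fps_to_fls (f i))"
    and f_x_integral: "\<forall>i\<in>{1..m}. fps_integral_coeffs (fps_compose (f i) x)"
    and f_\<phi>_conv: "\<forall>i\<in>{1..m}.
                    fps_compose (complex_fps (f i)) (fps_expansion \<phi> 0) \<in> O_closed_disc"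
  shows "(\<forall>i\<in>{1..m}. algebraic_over (rat_adjoin fls_X) (fps_to_fls (f i))) \<and>
         real m \<le> exp 1 * ((\<integral>z. log_plus (norm (ratfun_eval p (\<phi> z))) \<partial>haar_circle)
                              / ln (norm (deriv \<phi> 0)))"
proof
  define h where "h = ratfun_fps p"
  define \<Phi> where "\<Phi> = fps_expansion \<phi> 0"
  define P where "P = (\<lambda>z. ratfun_eval p (\<phi> z))"
  define T where "T = (\<integral>z. log_plus (norm (P z)) \<partial>haar_circle)"
  define L where "L = ln (norm (deriv \<phi> 0))"
  define g where "g i = eval_fps (complex_fps (f i) oo \<Phi>)" for i
  have "0 < L" unfolding L_def using \<phi>_deriv by (rule ln_gt_zero)
  have "0 \<le> T" by (simp add: T_def log_plus_nonneg)
  have \<phi>_exp: "\<phi> has_fps_expansion \<Phi>"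
    unfolding \<Phi>_def using \<phi>_holo by (intro analytic_at_imp_has_fps_expansion_0) (auto intro: analytic_on_subset)
  have \<Phi>_0: "fps_nth \<Phi> 0 = 0" and \<Phi>_1: "fps_nth \<Phi> 1 = deriv \<phi> 0"
    by (simp_all add: fps_nth_fps_expansion[OF \<phi>_exp] \<phi>_0)
  have h_nonconst: "h \<noteq> fps_const (fps_nth h 0)"
    unfolding h_def by (rule ratfun_fps_nonconst[OF p_nonconst p_no_pole])
  have P_exp: "P has_fps_expansion (complex_fps h oo \<Phi>)"
    unfolding P_def h_def by (rule ratfun_eval_compose_has_fps_expansion[OF p_no_pole \<phi>_exp \<Phi>_0])
  \<comment> \<open>Stated for arbitrary families, since it is applied both to the given series and
    to the powers of a single one.\<close>
  have bound: "real M * L \<le> 2 * T"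
    if "lin_indep_over (rat_adjoin (fps_to_fls h)) {..<M} (\<lambda>i. fps_to_fls (F i))"
      "\<And>i. i < M \<Longrightarrow> fps_integral_coeffs (F i oo x)"
      "\<And>i. i < M \<Longrightarrow> G i analytic_on cball 0 1"
      "\<And>i. i < M \<Longrightarrow> G i has_fps_expansion (complex_fps (F i) oo \<Phi>)" for M F G
    using dimension_bound[OF h_nonconst x_0 x_1 p_x_integral[folded h_def] \<Phi>_0 \<phi>_deriv[folded \<Phi>_1]
        p_\<phi>_holo[folded P_def] P_exp that]
    by (simp only: \<Phi>_1 T_def L_def)
  have g: "g i analytic_on cball 0 1" "g i has_fps_expansion (complex_fps (f i) oo \<Phi>)"
    if "i \<in> {1..m}" for i
    using O_closed_disc_eval_fps f_\<phi>_conv that unfolding g_def \<Phi>_def by blast+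
  show "\<forall>i\<in>{1..m}. algebraic_over (rat_adjoin fls_X) (fps_to_fls (f i))"
  proof (intro ballI, rule ccontr)
    fix i assume i: "i \<in> {1..m}" and "\<not> algebraic_over (rat_adjoin fls_X) (fps_to_fls (f i))"
    then have "lin_indep_over (rat_adjoin (fps_to_fls h)) {..<M} (\<lambda>k. fps_to_fls (f i ^ k))" for M
      unfolding fps_to_fls_power h_def
      by (intro lin_indep_powers_of_not_algebraic[of "rat_adjoin fls_X"])
         (use rat_adjoin_subset[OF ratfun_fps_in_rat_adjoin_X[OF p_no_pole]]
           rat_adjoin_const[of 0 fls_X] in simp_all)
    \<comment> \<open>Integrality and analyticity pass from \<open>f i\<close> to all its powers, so
      the number \<open>M\<close> of independent series is unrestricted, although
      \<open>T / L\<close> is fixed.\<close>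
    then have "real M * L \<le> 2 * T" for M
    proof (rule bound[where G = "\<lambda>k z. g i z ^ k"])
      show "fps_integral_coeffs (f i ^ k oo x)" for k
        using f_x_integral i by (simp add: fps_compose_power[OF x_0, symmetric] fps_integral_coeffs_power)
      show "(\<lambda>z. g i z ^ k) analytic_on cball 0 1" for k
        by (intro analytic_intros g i)
      show "(\<lambda>z. g i z ^ k) has_fps_expansion (complex_fps (f i ^ k) oo \<Phi>)" for k
        using has_fps_expansion_power[OF g(2)[OF i]] by (simp add: fps_compose_power[OF \<Phi>_0])
    qed
    moreover obtain M :: nat where "2 * T / L < real M" using reals_Archimedean2 by blast
    then have "2 * T < real M * L" using \<open>0 < L\<close> by (simp add: pos_divide_less_eq)
    ultimately show False using not_le by blast
  qed
  have "real m * L \<le> 2 * T"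
    by (rule bound[OF lin_indep_over_Suc[OF f_indep[folded h_def]]])
       (use f_x_integral in \<open>auto intro!: g\<close>)
  \<comment> \<open>The constant \<open>2\<close> is weakened to \<open>exp 1\<close> through
    \<open>1 + 1 \<le> exp 1\<close>.\<close>
  also have "\<dots> \<le> exp 1 * T"
    using exp_ge_add_one_self[of 1] \<open>0 \<le> T\<close> by (intro mult_right_mono) auto
  finally show "real m \<le> exp 1 * ((\<integral>z. log_plus (norm (ratfun_eval p (\<phi> z))) \<partial>haar_circle)
                              / ln (norm (deriv \<phi> 0)))"
    using \<open>0 < L\<close> by (simp add: T_def P_def L_def field_simps)
qed

end
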